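(* Let $X,Y$ be nonzero Banach spaces over the same field ($\mathbb{R}$ or $\mathbb{C}$), let $1\leq p<\infty$ and $k\in\mathbb{N}$. Suppose $Z=[X\oplus Y]_{\ell_q}$, where $q\in(1,\infty)$ and $\frac{1}{q}+\frac{1}{q'}=1$. Then \[n_{(p,k)}(Z)\leq\max\Big\{\frac{1}{q},\frac{1}{q'}\Big\}.\]
   Context: $[X\oplus Y]_{\ell_q}$ denotes the $\ell_q$-sum, i.e. $X\oplus Y$ with norm $\|(x,y)\|=(\|x\|^q+\|y\|^q)^{1/q}$. For a Banach space $X$, $L(X)$ is the space of bounded linear operators on $X$, $S_X$ its unit sphere, $X^*$ its dual, and $\Pi_X=\{(x,x^* )\in S_X\times S_{X^*}: x^*(x)=1\}$. For $1\leq p<\infty$, $k\in\mathbb{N}$ and $\mathcal{T}=(T_1,\ldots,T_k)\in L(X)^k$, put $\|\mathcal{T}\|_p=\sup\{(\sum_{i=1}^k\|T_ix\|^p)^{1/p}:x\in S_X\}$ and $w_p(\mathcal{T})=\sup\{(\sum_{i=1}^k|x^*(T_ix)|^p)^{1/p}:(x,x^* )\in\Pi_X\}$. The $(p,k)$-th joint numerical index of $X$ is $n_{(p,k)}(X)=\inf\{w_p(\mathcal{T}):\mathcal{T}\in L(X)^k,\ \|\mathcal{T}\|_p=1\}$. *)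

theory Defs
  imports "HOL-Analysis.Analysis"
begin

(* The scalar fields R and C: real normed fields isometrically isomorphic to one of them.
   The instances below make every statement over this class available for both. *)
class real_or_complex_field = real_normed_field +
  assumes real_or_complex:
    "(\<exists>h::'a \<Rightarrow> real. bij h \<and> (\<forall>x y. h (x + y) = h x + h y) \<and> (\<forall>x y. h (x * y) = h x * h y) \<and>
        (\<forall>r x. h (scaleR r x) = r * h x) \<and> (\<forall>x. \<bar>h x\<bar> = norm x)) \<or>
     (\<exists>h::'a \<Rightarrow> complex. bij h \<and> (\<forall>x y. h (x + y) = h x + h y) \<and> (\<forall>x y. h (x * y) = h x * h y) \<and>
        (\<forall>r x. h (scaleR r x) = of_real r * h x) \<and> (\<forall>x. cmod (h x) = norm x))"

instance real :: real_or_complex_field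
  by standard (rule disjI1, rule exI[of _ "\<lambda>x. x"], simp add: bij_def scaleR_conv_of_real)

instance complex :: real_or_complex_field
  by standard (rule disjI2, rule exI[of _ "\<lambda>x. x"], simp add: bij_def scaleR_conv_of_real)

(* The scalar multiplication and the norm are explicit parameters, since the classes
   real_normed_vector and banach only cover real scalars and a single norm per type
   (the product type carries the l_2-sum norm). *)
locale banach_space = vector_space smul
  for smul :: "'k::real_or_complex_field \<Rightarrow> 'a::ab_group_add \<Rightarrow> 'a" +
  fixes nrm :: "'a \<Rightarrow> real"
  assumes nrm_nonneg: "0 \<le> nrm x"
    and nrm_eq_0_iff: "nrm x = 0 \<longleftrightarrow> x = 0"
    and nrm_triangle: "nrm (x + y) \<le> nrm x + nrm y"
    and nrm_scale: "nrm (smul c x) = norm c * nrm x"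
    and complete: "Metric_space.mcomplete UNIV (\<lambda>x y. nrm (x - y))"

definition unit_sphere :: "('a \<Rightarrow> real) \<Rightarrow> 'a set" where
  "unit_sphere nrm = {x. nrm x = 1}"

definition bounded_operators ::
    "('k::field \<Rightarrow> 'a::ab_group_add \<Rightarrow> 'a) \<Rightarrow> ('a \<Rightarrow> real) \<Rightarrow> ('a \<Rightarrow> 'a) set" where
  "bounded_operators smul nrm =
     {T. Vector_Spaces.linear smul smul T \<and> (\<exists>C. \<forall>x. nrm (T x) \<le> C * nrm x)}"

definition dual ::
    "('k::real_normed_field \<Rightarrow> 'a::ab_group_add \<Rightarrow> 'a) \<Rightarrow> ('a \<Rightarrow> real) \<Rightarrow> ('a \<Rightarrow> 'k) set" where
  "dual smul nrm =
     {f. Vector_Spaces.linear smul (*) f \<and> (\<exists>C. \<forall>x. norm (f x) \<le> C * nrm x)}"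

definition dual_norm :: "('a \<Rightarrow> real) \<Rightarrow> ('a \<Rightarrow> 'k::real_normed_field) \<Rightarrow> real" where
  "dual_norm nrm f = (SUP x\<in>{x. nrm x \<le> 1}. norm (f x))"

definition Pi_set ::
    "('k::real_normed_field \<Rightarrow> 'a::ab_group_add \<Rightarrow> 'a) \<Rightarrow> ('a \<Rightarrow> real) \<Rightarrow> ('a \<times> ('a \<Rightarrow> 'k)) set" where
  "Pi_set smul nrm =
     {(x, f). x \<in> unit_sphere nrm \<and> f \<in> dual smul nrm \<and> dual_norm nrm f = 1 \<and> f x = 1}"

(* A k-tuple of operators is a sequence T of which only T 0, ..., T (k - 1) are used. *)
definition joint_norm :: "('a \<Rightarrow> real) \<Rightarrow> real \<Rightarrow> nat \<Rightarrow> (nat \<Rightarrow> 'a \<Rightarrow> 'a) \<Rightarrow> real" where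
  "joint_norm nrm p k T =
     (SUP x\<in>unit_sphere nrm. (\<Sum>i<k. nrm (T i x) powr p) powr (1 / p))"

definition joint_numerical_radius ::
    "('k::real_normed_field \<Rightarrow> 'a::ab_group_add \<Rightarrow> 'a) \<Rightarrow> ('a \<Rightarrow> real) \<Rightarrow> real \<Rightarrow> nat \<Rightarrow>
     (nat \<Rightarrow> 'a \<Rightarrow> 'a) \<Rightarrow> real" where
  "joint_numerical_radius smul nrm p k T =
     (SUP (x, f)\<in>Pi_set smul nrm. (\<Sum>i<k. norm (f (T i x)) powr p) powr (1 / p))"

definition joint_numerical_index ::
    "('k::real_normed_field \<Rightarrow> 'a::ab_group_add \<Rightarrow> 'a) \<Rightarrow> ('a \<Rightarrow> real) \<Rightarrow> real \<Rightarrow> nat \<Rightarrow> real" where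
  "joint_numerical_index smul nrm p k =
     (INF T\<in>{T. (\<forall>i<k. T i \<in> bounded_operators smul nrm) \<and> joint_norm nrm p k T = 1}.
        joint_numerical_radius smul nrm p k T)"

definition lq_norm :: "real \<Rightarrow> ('a \<Rightarrow> real) \<Rightarrow> ('b \<Rightarrow> real) \<Rightarrow> 'a \<times> 'b \<Rightarrow> real" where
  "lq_norm q nX nY = (\<lambda>(x, y). (nX x powr q + nY y powr q) powr (1 / q))"

end

(* For norm-one x0 in X, y0 in Y and a functional g of norm one with g y0 = 1, the operator
   T (x, y) = (g y x0, 0) has norm one (complete it to a k-tuple by zeros). If f of norm one attains
   its norm at the unit vector z = (x, y), then (1 + t |f (x0, 0)|)^q <= (|x| + t)^q + |y|^q for
   t > 0, and letting t tend to 0 gives |f (x0, 0)| <= |x|^(q-1). Hence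
   |f (T z)| <= |y| |x|^(q-1) <= |y|^q / q + |x|^q / q' by Young's inequality, and
   |x|^q + |y|^q = 1.
   The functional g comes from the Hahn-Banach theorem, proved here by showing that minimal
   sublinear functionals are linear. *)
theory Submission
  imports Defs
begin

section \<open>The Hahn-Banach theorem\<close>

text \<open>The real scalar action \<open>s\<close> is explicit because it is later the restriction
  to real scalars of an action of the real or complex field.\<close>

definition sublinear :: "(real \<Rightarrow> 'a::ab_group_add \<Rightarrow> 'a) \<Rightarrow> ('a \<Rightarrow> real) \<Rightarrow> bool" where
  "sublinear s p \<longleftrightarrow> (\<forall>x y. p (x + y) \<le> p x + p y) \<and> (\<forall>r\<ge>0. \<forall>x. p (s r x) = r * p x)"

lemma sublinear_add: "sublinear s p \<Longrightarrow> p (x + y) \<le> p x + p y"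
  and sublinear_scale: "sublinear s p \<Longrightarrow> 0 \<le> r \<Longrightarrow> p (s r x) = r * p x"
  by (auto simp: sublinear_def)

context
  fixes s :: "real \<Rightarrow> 'a::ab_group_add \<Rightarrow> 'a"
  assumes vs: "vector_space s"
begin

interpretation vector_space s by (rule vs)

text \<open>For positive \<open>r\<close>, the scaling bound with factor \<open>1 / r\<close> at
  \<open>s r x\<close> gives the reverse inequality. For \<open>r = 0\<close> it says
  \<open>p 0 \<le> 0\<close>, and subadditivity at 0 gives the converse.\<close>

lemma sublinearI:
  assumes add: "\<And>x y. p (x + y) \<le> p x + p y"
    and scale: "\<And>r x. 0 \<le> r \<Longrightarrow> p (s r x) \<le> r * p x"
  shows "sublinear s p"
  unfolding sublinear_def
proof (intro conjI allI impI)
  fix r :: real and x assume "0 \<le> r"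
  then consider "r = 0" | "0 < r" by linarith
  then show "p (s r x) = r * p x"
  proof cases
    case 1
    then show ?thesis using scale[of 0 x] add[of 0 0] by simp
  next
    case 2
    have "p (s (1 / r) (s r x)) \<le> (1 / r) * p (s r x)"
      using 2 by (intro scale) simp
    then have "r * p x \<le> p (s r x)"
      using 2 by (simp add: field_simps)
    then show ?thesis using scale[of r x] 2 by simp
  qed
qed (rule add)

lemma sublinear_zero: "sublinear s p \<Longrightarrow> p 0 = 0"
  using sublinear_scale[of s p 0 0] by simp

lemma sublinear_minus: "sublinear s p \<Longrightarrow> - p (- x) \<le> p x"
  using sublinear_add[of s p x "- x"] sublinear_zero[of p] by simp

text \<open>The witness is the infimum of \<open>p (x + t y) - t p y\<close> over \<open>t \<ge> 0\<close>. Applied to a minimal \<open>p\<close> it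
  gives additivity; applied once beforehand it forces \<open>- p' (- y) \<ge> p y\<close>, so that every linear
  functional below \<open>p'\<close> agrees with \<open>p\<close> at \<open>y\<close>.\<close>

lemma sublinear_decrease:
  assumes p: "sublinear s p"
  obtains p' where "sublinear s p'" "\<And>x. p' x \<le> p x" "\<And>x. p' x \<le> p (x + y) - p y"
proof -
  define p' where "p' x = (INF t\<in>{0..}. p (x + s t y) - t * p y)" for x
  \<comment> \<open>Writing \<open>s t y\<close> as \<open>(x + s t y) + (- x)\<close> gives the
    lower bound \<open>- p (- x)\<close>, which does not depend on \<open>t\<close>.\<close>
  have bdd: "bdd_below ((\<lambda>t. p (x + s t y) - t * p y) ` {0..})" for x
  proof (rule bdd_belowI2)
    fix t :: real assume "t \<in> {0..}"
    then have "t * p y \<le> p (x + s t y) + p (- x)"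
      using sublinear_add[OF p, of "x + s t y" "- x"] sublinear_scale[OF p, of t y] by simp
    then show "- p (- x) \<le> p (x + s t y) - t * p y" by simp
  qed
  have le: "p' x \<le> p (x + s t y) - t * p y" if "0 \<le> t" for x t
    unfolding p'_def using that by (intro cINF_lower bdd) auto
  have ge: "c \<le> p' x" if "\<And>t. 0 \<le> t \<Longrightarrow> c \<le> p (x + s t y) - t * p y" for c x
    unfolding p'_def using that by (intro cINF_greatest) auto
  have "sublinear s p'"
  proof (rule sublinearI)
    fix x z
    \<comment> \<open>Parameters \<open>t\<close> for \<open>x\<close> and \<open>u\<close> for
      \<open>z\<close> combine to the admissible parameter \<open>t + u\<close> for
      \<open>x + z\<close>; the infima over \<open>u\<close> and \<open>t\<close> are then taken one
      after the other.\<close>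
    have "p' (x + z) - (p (x + s t y) - t * p y) \<le> p' z" if t: "0 \<le> t" for t
    proof (rule ge)
      fix u :: real assume u: "0 \<le> u"
      have "p' (x + z) \<le> p (x + z + s (t + u) y) - (t + u) * p y"
        using t u by (intro le) simp
      also have "x + z + s (t + u) y = (x + s t y) + (z + s u y)"
        by (simp add: scale_left_distrib)
      also have "p \<dots> \<le> p (x + s t y) + p (z + s u y)"
        by (rule sublinear_add[OF p])
      finally show "p' (x + z) - (p (x + s t y) - t * p y) \<le> p (z + s u y) - u * p y"
        by (simp add: algebra_simps)
    qed
    then have "p' (x + z) - p' z \<le> p' x"
      by (intro ge) (simp add: algebra_simps)
    then show "p' (x + z) \<le> p' x + p' z" by simp
  next
    fix r :: real and x assume "0 \<le> r"
    then consider "r = 0" | "0 < r" by linarith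
    then show "p' (s r x) \<le> r * p' x"
    proof cases
      case 1
      then show ?thesis using le[of 0 0] sublinear_zero[OF p] by simp
    next
      case 2
      have "p' (s r x) / r \<le> p' x"
      proof (rule ge)
        fix t :: real assume t: "0 \<le> t"
        have "p' (s r x) \<le> p (s r x + s (r * t) y) - (r * t) * p y"
          using t 2 by (intro le) simp
        also have "s r x + s (r * t) y = s r (x + s t y)"
          by (simp add: scale_right_distrib)
        also have "p \<dots> = r * p (x + s t y)"
          using 2 by (intro sublinear_scale[OF p]) simp
        finally show "p' (s r x) / r \<le> p (x + s t y) - t * p y"
          using 2 by (simp add: field_simps)
      qed
      then show ?thesis using 2 by (simp add: field_simps)
    qed
  qed
  moreover have "p' x \<le> p x" for x
    using le[of 0 x] by simp
  moreover have "p' x \<le> p (x + y) - p y" for x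
    using le[of 1 x] by simp
  ultimately show ?thesis by (rule that)
qed

text \<open>Zorn's lemma for the sublinear functionals below \<open>p\<close> in the reversed
  pointwise order. A nonempty chain is bounded by its pointwise infimum, which is finite because
  each member \<open>g\<close> satisfies \<open>- p (- x) \<le> g x\<close>.\<close>

lemma minimal_sublinear:
  assumes p: "sublinear s p"
  obtains m where "sublinear s m" "\<And>x. m x \<le> p x"
    "\<And>m' x. sublinear s m' \<Longrightarrow> (\<And>x. m' x \<le> m x) \<Longrightarrow> m' x = m x"
proof -
  define A where "A = {g. sublinear s g \<and> g \<le> p}"
  have "\<exists>m\<in>A. \<forall>a\<in>A. m \<ge> a \<longrightarrow> a = m"
  proof (rule predicate_Zorn)
    show "partial_order_on A (relation_of (\<ge>) A)"
      by (rule partial_order_on_relation_ofI) auto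
  next
    fix C assume C: "C \<in> Chains (relation_of (\<ge>) A)"
    then have CA: "g \<in> A" if "g \<in> C" for g
      using that by (auto simp: Chains_def relation_of_def)
    have chain: "g \<ge> h \<or> h \<ge> g" if "g \<in> C" "h \<in> C" for g h
      using that C by (auto simp: Chains_def relation_of_def)
    show "\<exists>u\<in>A. \<forall>a\<in>C. u \<le> a"
    proof (cases "C = {}")
      case True
      then show ?thesis using p by (auto simp: A_def)
    next
      case False
      define u where "u x = (INF g\<in>C. g x)" for x
      have sub: "sublinear s g" "g x \<le> p x" if "g \<in> C" for g x
        using CA[OF that] by (auto simp: A_def le_fun_def)
      have bdd: "bdd_below ((\<lambda>g. g x) ` C)" for x
      proof (rule bdd_belowI2)
        fix g assume "g \<in> C"
        then show "- p (- x) \<le> g x"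
          using sublinear_minus[OF sub(1), of g x] sub(2)[of g "- x"] by simp
      qed
      have le: "u x \<le> g x" if "g \<in> C" for g x
        unfolding u_def using that by (intro cINF_lower bdd)
      have ge: "c \<le> u x" if "\<And>g. g \<in> C \<Longrightarrow> c \<le> g x" for c x
        unfolding u_def using that False by (intro cINF_greatest)
      have "sublinear s u"
      proof (rule sublinearI)
        fix x y
        have "u (x + y) - g x \<le> u y" if g: "g \<in> C" for g
        proof (rule ge)
          fix h assume h: "h \<in> C"
          \<comment> \<open>The chain property provides one member below both \<open>g\<close> and
            \<open>h\<close>, whose subadditivity passes to the infimum.\<close>
          obtain m where m: "m \<in> C" "m \<le> g" "m \<le> h"
            using chain[OF g h] g h by blast
          have "u (x + y) \<le> m x + m y"
            using le[OF m(1), of "x + y"] sublinear_add[OF sub(1)[OF m(1)], of x y] by linarith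
          then show "u (x + y) - g x \<le> h y"
            using le_funD[OF m(2), of x] le_funD[OF m(3), of y] by linarith
        qed
        then have "u (x + y) - u y \<le> u x"
          by (intro ge) (simp add: algebra_simps)
        then show "u (x + y) \<le> u x + u y" by simp
      next
        fix r :: real and x assume "0 \<le> r"
        then consider "r = 0" | "0 < r" by linarith
        then show "u (s r x) \<le> r * u x"
        proof cases
          case 1
          obtain g where "g \<in> C" using False by blast
          then show ?thesis
            using 1 le[of g 0] sublinear_zero[OF sub(1), of g] by simp
        next
          case 2
          have "u (s r x) / r \<le> u x"
          proof (rule ge)
            fix g assume g: "g \<in> C"
            show "u (s r x) / r \<le> g x"
              using le[OF g, of "s r x"] sublinear_scale[OF sub(1)[OF g], of r x] 2
              by (simp add: field_simps)
          qed
          then show ?thesis using 2 by (simp add: field_simps)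
        qed
      qed
      moreover obtain g where "g \<in> C" using False by blast
      then have "u \<le> p"
        by (intro le_funI order_trans[OF le sub(2)])
      ultimately show ?thesis
        using le by (auto simp: A_def le_fun_def)
    qed
  qed
  then obtain m where m: "m \<in> A" "\<And>a. a \<in> A \<Longrightarrow> a \<le> m \<Longrightarrow> a = m" by blast
  show ?thesis
  proof (rule that)
    show "sublinear s m" "m x \<le> p x" for x using m(1) by (auto simp: A_def le_fun_def)
    fix m' x assume "sublinear s m'" "\<And>x. m' x \<le> m x"
    then have "m' = m"
      using m(1) by (intro m(2)) (auto simp: A_def le_fun_def intro: order_trans)
    then show "m' x = m x" by simp
  qed
qed

theorem hahn_banach_sublinear:
  assumes p: "sublinear s p"
  obtains \<phi> where "\<And>x y. \<phi> (x + y) = \<phi> x + \<phi> y" "\<And>r x. \<phi> (s r x) = r * \<phi> x"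
    "\<And>x. \<phi> x \<le> p x" "\<phi> x0 = p x0"
proof -
  obtain p0 where p0: "sublinear s p0" "\<And>x. p0 x \<le> p x" "\<And>x. p0 x \<le> p (x + x0) - p x0"
    using sublinear_decrease[OF p, of x0] by blast
  obtain m where m: "sublinear s m" "\<And>x. m x \<le> p0 x"
    "\<And>m' x. sublinear s m' \<Longrightarrow> (\<And>x. m' x \<le> m x) \<Longrightarrow> m' x = m x"
    using minimal_sublinear[OF p0(1)] by blast
  have add: "m (x + y) = m x + m y" for x y
  proof -
    obtain m' where m': "sublinear s m'" "\<And>x. m' x \<le> m x" "\<And>x. m' x \<le> m (x + y) - m y"
      using sublinear_decrease[OF m(1), of y] by blast
    \<comment> \<open>Minimality forces \<open>m' = m\<close>, so the third property of
      \<open>m'\<close> becomes superadditivity of \<open>m\<close>.\<close>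
    have "m x + m y \<le> m (x + y)"
      using m(3)[OF m'(1,2), of x] m'(3)[of x] by simp
    then show ?thesis using sublinear_add[OF m(1), of x y] by simp
  qed
  have neg: "m (- x) = - m x" for x
    using add[of x "- x"] sublinear_zero[OF m(1)] by simp
  have scale: "m (s r x) = r * m x" for r x
  proof (cases "0 \<le> r")
    case True
    then show ?thesis by (rule sublinear_scale[OF m(1)])
  next
    case False
    then have "m (s (- r) x) = - r * m x" by (intro sublinear_scale[OF m(1)]) simp
    then show ?thesis using neg[of "s r x"] by simp
  qed
  \<comment> \<open>At \<open>- x0\<close> the third property of \<open>p0\<close> reads
    \<open>p0 (- x0) \<le> p 0 - p x0\<close>; oddness of \<open>m\<close> then turns the bound into
    \<open>p x0 \<le> m x0\<close>.\<close>
  have "m (- x0) \<le> - p x0"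
    using m(2)[of "- x0"] p0(3)[of "- x0"] sublinear_zero[OF p] by simp
  then have "m x0 = p x0"
    using neg[of x0] m(2)[of x0] p0(2)[of x0] by simp
  then show ?thesis
    using add scale order_trans[OF m(2) p0(2)] by (intro that[of m])
qed

end

text \<open>Pulling coordinates back along the isomorphism of the class axiom gives facts inside the
  field itself: every scalar is real, or there is an imaginary unit \<open>i\<close> and the norm is
  Euclidean in the coordinates.\<close>

lemma real_or_complex_cases:
  obtains (real) "\<And>z::'k::real_or_complex_field. \<exists>a. z = of_real a"
  | (complex) i :: "'k::real_or_complex_field" where "i * i = - 1"
      "\<And>z. \<exists>a b. z = of_real a + of_real b * i"
      "\<And>a b. norm (of_real a + of_real b * i) = sqrt (a\<^sup>2 + b\<^sup>2)"
  using real_or_complex[where ?'a = 'k]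
proof (elim disjE exE conjE)
  fix h :: "'k \<Rightarrow> real"
  assume h: "bij h" "\<forall>x y. h (x + y) = h x + h y" "\<forall>x y. h (x * y) = h x * h y"
    "\<forall>r x. h (r *\<^sub>R x) = r * h x" "\<forall>x. \<bar>h x\<bar> = norm x"
  have inj: "x = y" if "h x = h y" for x y
    using h(1) that by (auto simp: bij_def inj_def)
  \<comment> \<open>The class axiom does not state that \<open>h\<close> preserves 1; this follows
    since \<open>h 1\<close> is an idempotent of absolute value one.\<close>
  have "h 1 * h 1 = h 1" using h(3) by (metis mult_1)
  moreover have "\<bar>h 1\<bar> = 1" using h(5) by simp
  ultimately have h1: "h 1 = 1" by auto
  show thesis
  proof (rule real)
    fix z :: 'k
    have "z = of_real (h z)" by (rule inj) (simp add: of_real_def h(4) h1)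
    then show "\<exists>a. z = of_real a" by blast
  qed
next
  fix h :: "'k \<Rightarrow> complex"
  assume h: "bij h" "\<forall>x y. h (x + y) = h x + h y" "\<forall>x y. h (x * y) = h x * h y"
    "\<forall>r x. h (r *\<^sub>R x) = of_real r * h x" "\<forall>x. cmod (h x) = norm x"
  have inj: "x = y" if "h x = h y" for x y
    using h(1) that by (auto simp: bij_def inj_def)
  have "h 1 * h 1 = h 1" using h(3) by (metis mult_1)
  moreover have "cmod (h 1) = 1" using h(5) by simp
  ultimately have h1: "h 1 = 1" by auto
  have hr: "h (of_real a) = of_real a" for a by (simp add: of_real_def[where ?'a='k] h(4) h1)
  obtain i where i: "h i = \<i>" using h(1) by (metis bij_pointE)
  show thesis
  proof (rule complex)
    show "i * i = - 1"
      by (rule inj) (use hr[of "-1"] in \<open>simp add: h(3) i\<close>)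
    fix z :: 'k
    have "z = of_real (Re (h z)) + of_real (Im (h z)) * i"
      by (rule inj) (simp add: h(2,3) hr i complex_eq_iff)
    then show "\<exists>a b. z = of_real a + of_real b * i" by blast
  next
    fix a b
    have "norm (of_real a + of_real b * i) = cmod (of_real a + of_real b * \<i>)"
      using h(5) by (metis h(2,3) hr i)
    then show "norm (of_real a + of_real b * i) = sqrt (a\<^sup>2 + b\<^sup>2)"
      by (simp add: cmod_def)
  qed
qed

text \<open>The witness for nonzero \<open>z\<close> is \<open>norm z / z\<close>. It serves to
  rotate a vector so that a linear functional takes there the real value given by its
  modulus.\<close>

lemma unimodular_rotation:
  fixes z :: "'k::real_normed_field"
  obtains c where "norm c = 1" "c * z = of_real (norm z)"
proof (cases "z = 0")
  case True
  then show ?thesis using that[of 1] by simp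
next
  case False
  then show ?thesis using that[of "of_real (norm z) / z"] by (simp add: norm_divide)
qed

lemma vector_space_times: "vector_space ((*) :: 'k::field \<Rightarrow> 'k \<Rightarrow> 'k)"
  by unfold_locales (simp_all add: algebra_simps)

text \<open>Over the real scalars \<open>nrm\<close> is sublinear, so it dominates a real-linear
  \<open>\<phi>\<close> that agrees with it at \<open>x0\<close>. For complex scalars
  \<open>\<phi>\<close> is then completed to a complex-linear functional.\<close>

theorem hahn_banach_norming:
  fixes s :: "'k::real_or_complex_field \<Rightarrow> 'a::ab_group_add \<Rightarrow> 'a"
  assumes vs: "vector_space s"
    and tri: "\<And>x y. nrm (x + y) \<le> nrm x + nrm y"
    and hom: "\<And>c x. nrm (s c x) = norm c * nrm x"
  obtains f where "Vector_Spaces.linear s (*) f" "\<And>x. norm (f x) \<le> nrm x"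
    "f x0 = of_real (nrm x0)"
proof -
  interpret vector_space s by (rule vs)
  let ?r = "\<lambda>r. s (of_real r)"
  have vsr: "vector_space ?r"
    by unfold_locales (simp_all add: scale_right_distrib scale_left_distrib)
  have "sublinear ?r nrm"
    by (simp add: sublinear_def tri hom)
  then obtain \<phi> where \<phi>: "\<And>x y. \<phi> (x + y) = \<phi> x + \<phi> y" "\<And>r x. \<phi> (?r r x) = r * \<phi> x"
    "\<And>x. \<phi> x \<le> nrm x" "\<phi> x0 = nrm x0"
    using hahn_banach_sublinear[OF vsr, of nrm x0] by metis
  have linearI: "Vector_Spaces.linear s (*) f"
    if "\<And>x y. f (x + y) = f x + f y" "\<And>c x. f (s c x) = c * f x" for f :: "'a \<Rightarrow> 'k"
    using vs vector_space_times that by (simp add: Vector_Spaces.linear_iff)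
  show ?thesis
  proof (cases rule: real_or_complex_cases[where ?'k = 'k])
    case real
    let ?f = "\<lambda>x. of_real (\<phi> x) :: 'k"
    show ?thesis
    proof (rule that[of ?f])
      show "Vector_Spaces.linear s (*) ?f"
      proof (rule linearI)
        fix c :: 'k and x
        obtain a where "c = of_real a" using real by blast
        then show "?f (s c x) = c * ?f x" by (simp add: \<phi>(2))
      qed (simp add: \<phi>(1))
      have "- \<phi> x \<le> nrm x" for x
        using \<phi>(2)[of "- 1" x] \<phi>(3)[of "?r (- 1) x"] hom[of "- 1" x] by simp
      then show "norm (?f x) \<le> nrm x" for x
        using \<phi>(3)[of x] by (simp add: abs_le_iff)
    qed (simp add: \<phi>(4))
  next
    case (complex i)
    \<comment> \<open>Complex linearity leaves no other choice: a functional with real part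
      \<open>\<phi>\<close> has imaginary part \<open>- \<phi> (s i x)\<close>.\<close>
    let ?f = "\<lambda>x. of_real (\<phi> x) - of_real (\<phi> (s i x)) * i"
    have ii: "i * (i * z) = - z" for z
      using complex(1) by (simp flip: mult.assoc)
    have scale: "?f (s c x) = c * ?f x" for c x
    proof -
      obtain a b where c: "c = of_real a + of_real b * i" using complex(2) by blast
      have 1: "s c x = ?r a x + ?r b (s i x)"
        by (simp add: c scale_left_distrib)
      have 2: "s i (s c x) = ?r a (s i x) + ?r (- b) x"
      proof -
        have "i * c = of_real a * i + of_real (- b)"
          using complex(1) by (simp add: c algebra_simps ii)
        then show ?thesis by (simp add: scale_left_distrib del: of_real_minus)
      qed
      show ?thesis
        unfolding 2 unfolding 1 \<phi>(1,2)
        by (simp add: c algebra_simps complex(1) ii)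
    qed
    have lin: "Vector_Spaces.linear s (*) ?f"
      by (rule linearI) (simp_all only: scale, simp add: \<phi>(1) scale_right_distrib algebra_simps)
    have norm_f: "norm (?f x) = sqrt ((\<phi> x)\<^sup>2 + (\<phi> (s i x))\<^sup>2)" for x
      using complex(3)[of "\<phi> x" "- \<phi> (s i x)"] by simp
    have bound: "norm (?f x) \<le> nrm x" for x
    proof -
      \<comment> \<open>After rotating \<open>x\<close> by \<open>c\<close> the value of
        \<open>?f\<close> is real, hence equal to its real part \<open>\<phi> (s c x)\<close>, which
        \<open>nrm\<close> dominates.\<close>
      obtain c where c: "norm c = 1" "c * ?f x = of_real (norm (?f x))"
        by (rule unimodular_rotation)
      have "of_real (\<phi> (s c x) - norm (?f x)) + of_real (- \<phi> (s i (s c x))) * i = 0"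
        using scale[of c x] c(2) by (simp add: algebra_simps)
      then have "sqrt ((\<phi> (s c x) - norm (?f x))\<^sup>2 + (- \<phi> (s i (s c x)))\<^sup>2) = 0"
        using complex(3) by (metis norm_zero)
      then have "norm (?f x) = \<phi> (s c x)"
        by (simp add: sum_power2_eq_zero_iff)
      also have "\<dots> \<le> nrm x" using \<phi>(3)[of "s c x"] by (simp add: hom c(1))
      finally show ?thesis .
    qed
    \<comment> \<open>At \<open>x0\<close> the real part already has the maximal modulus
      \<open>nrm x0\<close>, so the imaginary part vanishes.\<close>
    have "(\<phi> (s i x0))\<^sup>2 \<le> 0"
    proof -
      have "sqrt ((\<phi> x0)\<^sup>2 + (\<phi> (s i x0))\<^sup>2) \<le> \<phi> x0"
        using bound[of x0] unfolding norm_f by (simp add: \<phi>(4))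
      then show ?thesis
        using sqrt_le_D by force
    qed
    then have "?f x0 = of_real (nrm x0)" by (simp add: \<phi>(4))
    then show ?thesis using lin bound by (intro that[of ?f])
  qed
qed

section \<open>Real inequalities\<close>

text \<open>The graph of the \<open>q\<close>-th power lies above its tangent at \<open>c\<close>:
  this is Young's inequality for \<open>x\<close> and \<open>c powr (q - 1)\<close> with exponents
  \<open>q\<close> and \<open>q / (q - 1)\<close>.\<close>

lemma powr_tangent:
  fixes q x c :: real
  assumes "1 < q" "0 \<le> x" "0 \<le> c"
  shows "c powr q + q * c powr (q - 1) * (x - c) \<le> x powr q"
proof -
  define q' where "q' = q / (q - 1)"
  have q': "1 < q'" "1 / q + 1 / q' = 1" "(q - 1) * q' = q" "1 / q' = (q - 1) / q"
    using assms(1) by (auto simp: q'_def field_simps)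
  have "x * c powr (q - 1) \<le> x powr q / q + (c powr (q - 1)) powr q' / q'"
    using assms q'(1,2) by (intro Youngs_inequality) auto
  also have "(c powr (q - 1)) powr q' / q' = c powr q * (1 / q')"
    by (simp add: powr_powr q'(3))
  also have "\<dots> = c powr q * ((q - 1) / q)" by (simp only: q'(4))
  finally have "q * (x * c powr (q - 1)) \<le> x powr q + (q - 1) * c powr q"
    using assms(1) by (simp add: field_simps)
  moreover have "c powr (q - 1) * c = c powr q"
    using assms(3) by (cases "c = 0") (auto simp: powr_diff)
  ultimately show ?thesis by (simp add: algebra_simps)
qed

text \<open>With \<open>c = a + t\<close>, the tangent at 1 bounds \<open>(1 + t * u) powr q\<close>
  from below and the tangent at \<open>c\<close> bounds \<open>c powr q - a powr q\<close> from
  above. Dividing by \<open>q * t\<close> gives \<open>u \<le> c powr (q - 1)\<close>, and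
  \<open>c\<close> tends to \<open>a\<close>.\<close>

lemma support_slope_le:
  fixes a b u q :: real
  assumes q: "1 < q" and nonneg: "0 \<le> a" "0 \<le> b" "0 \<le> u" and unit: "a powr q + b powr q = 1"
    and support: "\<And>t. 0 < t \<Longrightarrow> 1 + t * u \<le> ((a + t) powr q + b powr q) powr (1 / q)"
  shows "u \<le> a powr (q - 1)"
proof -
  have step: "u \<le> c powr (q - 1)" if c: "a < c" for c
  proof -
    define t where "t = c - a"
    have t: "0 < t" "c = a + t" using c by (auto simp: t_def)
    have "1 + q * (t * u) \<le> (1 + t * u) powr q"
      using powr_tangent[of q "1 + t * u" 1] q t(1) nonneg by simp
    also have "\<dots> \<le> (((a + t) powr q + b powr q) powr (1 / q)) powr q"
      using support[OF t(1)] q t(1) nonneg by (intro powr_mono2) auto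
    also have "\<dots> = c powr q + b powr q"
      using q by (simp add: powr_powr t(2))
    also have "\<dots> = 1 + (c powr q - a powr q)"
      using unit by simp
    also have "c powr q - a powr q \<le> q * (t * c powr (q - 1))"
      using powr_tangent[of q a c] q nonneg t by (simp add: algebra_simps)
    finally show ?thesis using q t(1) by simp
  qed
  \<comment> \<open>Taking the root first turns the limit into a comparison with every
    \<open>c\<close> above \<open>a\<close>, so no continuity argument is needed.\<close>
  have "u powr (1 / (q - 1)) \<le> a"
  proof (rule dense_ge)
    fix c assume c: "a < c"
    then have "u powr (1 / (q - 1)) \<le> (c powr (q - 1)) powr (1 / (q - 1))"
      using step[OF c] q nonneg by (intro powr_mono2) auto
    then show "u powr (1 / (q - 1)) \<le> c"
      using q c nonneg by (simp add: powr_powr)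
  qed
  then have "(u powr (1 / (q - 1))) powr (q - 1) \<le> a powr (q - 1)"
    using q by (intro powr_mono2) auto
  then show ?thesis using q nonneg by (simp add: powr_powr)
qed

text \<open>Since \<open>(q - 1) * q' = q\<close>, Young's inequality bounds the product by a convex
  combination of \<open>1 / q\<close> and \<open>1 / q'\<close> with weights \<open>b powr q\<close>
  and \<open>a powr q\<close>.\<close>

lemma Youngs_inequality_max:
  fixes a b q q' :: real
  assumes q: "1 < q" "1 / q + 1 / q' = 1" and "0 \<le> a" "0 \<le> b" "a powr q + b powr q = 1"
  shows "b * a powr (q - 1) \<le> max (1 / q) (1 / q')"
proof -
  have "1 / q' = (q - 1) / q" using q by (simp add: field_simps)
  then have q'eq: "q' = q / (q - 1)" by (metis inverse_divide inverse_eq_divide inverse_inverse_eq)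
  have q': "1 < q'" "(q - 1) * q' = q" using q(1) by (auto simp: q'eq field_simps)
  have "b * a powr (q - 1) \<le> b powr q / q + (a powr (q - 1)) powr q' / q'"
    using assms q' by (intro Youngs_inequality) auto
  also have "\<dots> = b powr q * (1 / q) + a powr q * (1 / q')"
    by (simp add: powr_powr q'(2))
  also have "\<dots> \<le> b powr q * max (1 / q) (1 / q') + a powr q * max (1 / q) (1 / q')"
    by (intro add_mono mult_left_mono) auto
  also have "\<dots> = max (1 / q) (1 / q')"
    using assms(5) by (simp flip: distrib_right add: add.commute)
  finally show ?thesis .
qed


section \<open>Joint numerical radius and index\<close>

context
  fixes s :: "'k::real_normed_field \<Rightarrow> 'a::ab_group_add \<Rightarrow> 'a" and nrm :: "'a \<Rightarrow> real"
  assumes vs: "vector_space s"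
    and nonneg: "\<And>x. 0 \<le> nrm x"
    and definite: "\<And>x. nrm x = 0 \<Longrightarrow> x = 0"
    and hom: "\<And>c x. nrm (s c x) = norm c * nrm x"
begin

interpretation vector_space s by (rule vs)

lemma Pi_setI:
  assumes "Vector_Spaces.linear s (*) f" "\<And>x. norm (f x) \<le> nrm x" "nrm x = 1" "f x = 1"
  shows "(x, f) \<in> Pi_set s nrm"
proof -
  have "dual_norm nrm f = 1"
    unfolding dual_norm_def
  proof (rule cSup_eq_maximum)
    show "1 \<in> (\<lambda>x. norm (f x)) ` {x. nrm x \<le> 1}"
      using assms(3,4) by (intro image_eqI[of _ _ x]) auto
  qed (use assms(2) in \<open>auto intro: order_trans\<close>)
  moreover have "\<exists>C. \<forall>x. norm (f x) \<le> C * nrm x"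
    using assms(2) by (intro exI[of _ 1]) simp
  ultimately show ?thesis
    using assms by (auto simp: Pi_set_def dual_def unit_sphere_def)
qed

text \<open>The last conclusion extends the bound from the unit ball, where \<open>dual_norm\<close>
  gives it, to all vectors by homogeneity; a vector of norm 0 is 0.\<close>

lemma Pi_setD:
  assumes "(x, f) \<in> Pi_set s nrm"
  shows "nrm x = 1" "f x = 1" "Vector_Spaces.linear s (*) f" "norm (f y) \<le> nrm y"
proof -
  show "nrm x = 1" "f x = 1" and lin: "Vector_Spaces.linear s (*) f"
    using assms by (auto simp: Pi_set_def dual_def unit_sphere_def)
  from lin interpret f: Vector_Spaces.linear s "(*)" f .
  obtain C where C: "\<And>x. norm (f x) \<le> C * nrm x"
    using assms by (auto simp: Pi_set_def dual_def)
  \<comment> \<open>A real supremum dominates the values only once they are known to be bounded. The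
    bound is \<open>\<bar>C\<bar>\<close> because \<open>C\<close> may have either sign.\<close>
  have "bdd_above ((\<lambda>x. norm (f x)) ` {x. nrm x \<le> 1})"
  proof (rule bdd_aboveI2)
    fix x assume "x \<in> {x. nrm x \<le> 1}"
    then have "\<bar>C\<bar> * nrm x \<le> \<bar>C\<bar> * 1"
      by (intro mult_left_mono) auto
    moreover have "C * nrm x \<le> \<bar>C\<bar> * nrm x"
      by (intro mult_right_mono nonneg) auto
    ultimately show "norm (f x) \<le> \<bar>C\<bar>" using C[of x] by linarith
  qed
  then have unit: "norm (f x) \<le> 1" if "nrm x \<le> 1" for x
    using assms that cSUP_upper[of x "{x. nrm x \<le> 1}" "\<lambda>x. norm (f x)"]
    by (auto simp: Pi_set_def dual_norm_def)
  show "norm (f y) \<le> nrm y"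
  proof (cases "nrm y = 0")
    case True
    then show ?thesis using definite[OF True] f.zero by simp
  next
    case False
    then have "0 < nrm y" using nonneg[of y] by simp
    then have "norm (f (s (of_real (1 / nrm y)) y)) \<le> 1"
      by (intro unit) (simp add: hom norm_divide)
    then have "1 / nrm y * norm (f y) \<le> 1"
      using \<open>0 < nrm y\<close> by (simp only: f.scale norm_mult norm_of_real) simp
    then show ?thesis
      using \<open>0 < nrm y\<close> by (simp add: field_simps)
  qed
qed

text \<open>On pairs of \<open>Pi_set\<close> the functional has norm one and the vector is a unit
  vector, so each \<open>norm (f (T i x))\<close> is at most an operator bound of
  \<open>T i\<close>.\<close>

lemma joint_numerical_radius_bdd:
  assumes "0 \<le> p" "\<And>i. i < k \<Longrightarrow> T i \<in> bounded_operators s nrm"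
  shows "bdd_above ((\<lambda>(x, f). (\<Sum>i<k. norm (f (T i x)) powr p) powr (1 / p)) ` Pi_set s nrm)"
proof -
  have "\<forall>i. \<exists>C. i < k \<longrightarrow> (\<forall>x. nrm (T i x) \<le> C * nrm x)"
    using assms(2) by (auto simp: bounded_operators_def)
  then obtain C where C: "\<And>i x. i < k \<Longrightarrow> nrm (T i x) \<le> C i * nrm x"
    by metis
  show ?thesis
  proof (rule bdd_aboveI2, clarify)
    fix x f assume xf: "(x, f) \<in> Pi_set s nrm"
    have "norm (f (T i x)) powr p \<le> C i powr p" if "i < k" for i
      using Pi_setD(4)[OF xf, of "T i x"] C[OF that, of x] Pi_setD(1)[OF xf] assms(1)
      by (intro powr_mono2) auto
    then show "(\<Sum>i<k. norm (f (T i x)) powr p) powr (1 / p) \<le> (\<Sum>i<k. C i powr p) powr (1 / p)"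
      using assms(1) by (intro powr_mono2[OF _ sum_nonneg sum_mono]) auto
  qed
qed

text \<open>A single admissible tuple bounds the infimum from above once the radii are bounded
  below. They are nonnegative because each dominates its value at one fixed pair, which is why
  \<open>Pi_set\<close> has to be nonempty.\<close>

lemma joint_numerical_index_le:
  assumes "0 \<le> p" "Pi_set s nrm \<noteq> {}"
    and T: "\<And>i. i < k \<Longrightarrow> T i \<in> bounded_operators s nrm" "joint_norm nrm p k T = 1"
    and B: "\<And>x f. (x, f) \<in> Pi_set s nrm \<Longrightarrow> (\<Sum>i<k. norm (f (T i x)) powr p) powr (1 / p) \<le> B"
  shows "joint_numerical_index s nrm p k \<le> B"
proof -
  obtain x f where xf: "(x, f) \<in> Pi_set s nrm" using assms(2) by auto
  have "joint_numerical_index s nrm p k \<le> joint_numerical_radius s nrm p k T"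
    unfolding joint_numerical_index_def
  proof (rule cINF_lower)
    show "bdd_below (joint_numerical_radius s nrm p k `
      {T. (\<forall>i<k. T i \<in> bounded_operators s nrm) \<and> joint_norm nrm p k T = 1})"
    proof (rule bdd_belowI2)
      fix S assume "S \<in> {T. (\<forall>i<k. T i \<in> bounded_operators s nrm) \<and> joint_norm nrm p k T = 1}"
      then show "0 \<le> joint_numerical_radius s nrm p k S"
        unfolding joint_numerical_radius_def
        using assms(1) by (intro cSUP_upper2[OF joint_numerical_radius_bdd xf]) auto
    qed
  qed (use T in auto)
  also have "\<dots> \<le> B"
    unfolding joint_numerical_radius_def using assms(2) B by (intro cSUP_least) auto
  finally show ?thesis .
qed

end

section \<open>The index of an lq-sum\<close>

theorem theorem3p7:
  fixes sX :: "'k::real_or_complex_field \<Rightarrow> 'a::ab_group_add \<Rightarrow> 'a" and nX :: "'a \<Rightarrow> real"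
    and sY :: "'k \<Rightarrow> 'b::ab_group_add \<Rightarrow> 'b" and nY :: "'b \<Rightarrow> real"
    and p q q' :: real and k :: nat
  assumes "banach_space sX nX" and "\<exists>x::'a. x \<noteq> 0"
    and "banach_space sY nY" and "\<exists>y::'b. y \<noteq> 0"
    and "1 \<le> p" and "1 \<le> k"
    and "1 < q" and "1 / q + 1 / q' = 1"
  shows "joint_numerical_index (module_prod.scale sX sY) (lq_norm q nX nY) p k
           \<le> max (1 / q) (1 / q')"
proof -
  interpret X: banach_space sX nX by fact
  interpret Y: banach_space sY nY by fact
  interpret P: vector_space_prod sX sY by unfold_locales

  \<comment> \<open>Norm and scalar action on the sum\<close>
  let ?s = "module_prod.scale sX sY" and ?n = "lq_norm q nX nY"
  have scale: "?s c (x, y) = (sX c x, sY c y)" for c x y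
    by (rule P.scale_prod)
  have nX0: "nX 0 = 0" and nY0: "nY 0 = 0"
    by (simp_all add: X.nrm_eq_0_iff Y.nrm_eq_0_iff)
  have n: "?n (x, y) = (nX x powr q + nY y powr q) powr (1 / q)" for x y
    by (simp add: lq_norm_def)
  have nonneg: "0 \<le> ?n z" for z
    by (cases z) (simp add: n)
  have definite: "z = 0" if "?n z = 0" for z
    using that X.nrm_eq_0_iff Y.nrm_eq_0_iff
    by (cases z) (auto simp: n zero_prod_def add_nonneg_eq_0_iff)
  have hom: "?n (?s c z) = norm c * ?n z" for c z
    using assms(7)
    by (cases z) (simp add: n scale X.nrm_scale Y.nrm_scale powr_mult X.nrm_nonneg Y.nrm_nonneg
        powr_powr flip: distrib_left)
  have vs: "vector_space ?s" by (rule P.p.vector_space_axioms)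
  have nx_le: "nX x \<le> ?n (x, y)" and ny_le: "nY y \<le> ?n (x, y)" for x y
  proof -
    have "(nX x powr q) powr (1 / q) \<le> ?n (x, y)" "(nY y powr q) powr (1 / q) \<le> ?n (x, y)"
      unfolding n using assms(7) by (auto intro!: powr_mono2)
    then show "nX x \<le> ?n (x, y)" "nY y \<le> ?n (x, y)"
      using assms(7) by (simp_all add: powr_powr X.nrm_nonneg Y.nrm_nonneg)
  qed
  have nx: "?n (x, 0) = nX x" for x
    using assms(7) by (simp add: n nY0 powr_powr X.nrm_nonneg)
  have ny: "?n (0, y) = nY y" for y
    using assms(7) by (simp add: n nX0 powr_powr Y.nrm_nonneg)

  \<comment> \<open>Unit vectors and norming functionals\<close>
  obtain x1 :: 'a where "x1 \<noteq> 0" using assms(2) by blast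
  then obtain x0 where x0: "nX x0 = 1"
    using X.nrm_scale[of "of_real (1 / nX x1)" x1] X.nrm_eq_0_iff[of x1]
    by (auto simp: X.nrm_nonneg norm_divide)
  obtain y1 :: 'b where "y1 \<noteq> 0" using assms(4) by blast
  then obtain y0 where y0: "nY y0 = 1"
    using Y.nrm_scale[of "of_real (1 / nY y1)" y1] Y.nrm_eq_0_iff[of y1]
    by (auto simp: Y.nrm_nonneg norm_divide)
  obtain f0 where f0: "Vector_Spaces.linear sX (*) f0" "\<And>x. norm (f0 x) \<le> nX x" "f0 x0 = 1"
    using hahn_banach_norming[OF X.vector_space_axioms X.nrm_triangle X.nrm_scale, of x0] x0 by auto
  obtain g where g: "Vector_Spaces.linear sY (*) g" "\<And>y. norm (g y) \<le> nY y" "g y0 = 1"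
    using hahn_banach_norming[OF Y.vector_space_axioms Y.nrm_triangle Y.nrm_scale, of y0] y0 by auto
  interpret f0: Vector_Spaces.linear sX "(*)" f0 by fact
  interpret g: Vector_Spaces.linear sY "(*)" g by fact

  \<comment> \<open>As \<open>f0\<close> norms \<open>x0\<close>, its composition with the first
    projection norms \<open>(x0, 0)\<close>.\<close>
  have Pi_ne: "Pi_set ?s ?n \<noteq> {}"
  proof -
    have "((x0, 0), \<lambda>z. f0 (fst z)) \<in> Pi_set ?s ?n"
    proof (rule Pi_setI)
      show "Vector_Spaces.linear ?s (*) (\<lambda>z. f0 (fst z))"
        using vs vector_space_times[where ?'k = 'k]
        by (simp add: Vector_Spaces.linear_iff scale f0.add f0.scale split_paired_all)
      show "norm (f0 (fst z)) \<le> ?n z" for z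
        using f0(2)[of "fst z"] nx_le[of "fst z" "snd z"] by simp
    qed (use x0 f0(3) vs nonneg definite hom in \<open>auto simp: nx\<close>)
    then show ?thesis by blast
  qed

  \<comment> \<open>The norm-one tuple\<close>
  define T where "T = (\<lambda>(x::'a, y). (sX (g y) x0, 0::'b))"
  define \<T> where "\<T> i = (if i = 0 then T else (\<lambda>z. 0))" for i :: nat
  have nT: "?n (T z) = norm (g (snd z))" for z
    by (cases z) (simp add: T_def nx X.nrm_scale x0)
  \<comment> \<open>A general \<open>h\<close> covers both the norm and the modulus of a functional.
    Index 0 lies in the range because \<open>1 \<le> k\<close>, and the other summands are
    \<open>0 powr p = 0\<close>.\<close>
  have collapse: "(\<Sum>i<k. h (\<T> i z) powr p) powr (1 / p) = h (T z)"
    if "h 0 = 0" "\<And>z. 0 \<le> h z" for h :: "'a \<times> 'b \<Rightarrow> real" and z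
  proof -
    have "(\<Sum>i<k. h (\<T> i z) powr p) = (\<Sum>i<k. if i = 0 then h (T z) powr p else 0)"
      by (intro sum.cong) (auto simp: \<T>_def that)
    also have "\<dots> = h (T z) powr p" using assms(6) by simp
    finally show ?thesis using assms(5) that(2) by (simp add: powr_powr)
  qed
  have n0: "?n 0 = 0" by (simp add: n nX0 nY0 zero_prod_def)
  have T_bounded: "\<T> i \<in> bounded_operators ?s ?n" for i
  proof -
    have "Vector_Spaces.linear ?s ?s (\<T> i)"
      using vs
      by (simp add: Vector_Spaces.linear_iff \<T>_def T_def scale split_paired_all g.add g.scale
          X.scale_left_distrib zero_prod_def)
    moreover have "?n (\<T> i z) \<le> 1 * ?n z" for z
      using g(2)[of "snd z"] ny_le[of "snd z" "fst z"] nonneg[of z]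
      by (simp add: \<T>_def nT n0)
    ultimately show ?thesis unfolding bounded_operators_def by blast
  qed
  have T_norm: "joint_norm ?n p k \<T> = 1"
    unfolding joint_norm_def collapse[of ?n, OF n0 nonneg] nT
  proof (rule cSup_eq_maximum)
    show "1 \<in> (\<lambda>z. norm (g (snd z))) ` unit_sphere ?n"
      using y0 g(3) by (intro image_eqI[of _ _ "(0, y0)"]) (auto simp: unit_sphere_def ny)
    show "r \<le> 1" if r: "r \<in> (\<lambda>z. norm (g (snd z))) ` unit_sphere ?n" for r
    proof -
      obtain x y where "?n (x, y) = 1" "r = norm (g y)"
        using r by (auto simp: unit_sphere_def)
      then show ?thesis using g(2)[of y] ny_le[of y x] by simp
    qed
  qed

  \<comment> \<open>Estimate of the joint numerical radius\<close>
  show ?thesis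
  proof (rule joint_numerical_index_le[of ?s ?n p k \<T>])
    fix z f assume zf: "(z, f) \<in> Pi_set ?s ?n"
    note f = Pi_setD[OF vs nonneg definite hom zf]
    interpret f: Vector_Spaces.linear ?s "(*)" f by (rule f(3))
    obtain x y where z: "z = (x, y)" by fastforce
    define u where "u = norm (f (x0, 0))"
    have "((nX x powr q + nY y powr q) powr (1 / q)) powr q = 1"
      using f(1) by (simp add: z n)
    then have unit: "nX x powr q + nY y powr q = 1"
      using assms(7) by (simp add: powr_powr)
    \<comment> \<open>Moving \<open>z\<close> by \<open>t\<close> in the direction
      \<open>c (x0, 0)\<close> raises the value of \<open>f\<close> from 1 to exactly
      \<open>1 + t * u\<close>, while the norm of the first component grows by at most
      \<open>t\<close>.\<close>
    obtain c where c: "norm c = 1" "c * f (x0, 0) = of_real u"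
      unfolding u_def by (rule unimodular_rotation)
    have "u \<le> nX x powr (q - 1)"
    proof (rule support_slope_le[OF assms(7) X.nrm_nonneg Y.nrm_nonneg _ unit])
      fix t :: real assume t: "0 < t"
      have "f (x + sX (of_real t * c) x0, y) = f (z + ?s (of_real t * c) (x0, 0))"
        by (simp add: z scale)
      also have "\<dots> = 1 + of_real t * (c * f (x0, 0))"
        by (simp only: f.add f.scale f(2) mult.assoc)
      also have "\<dots> = of_real (1 + t * u)" by (simp add: c(2))
      finally have "1 + t * u = norm (f (x + sX (of_real t * c) x0, y))"
        using t by (simp add: u_def del: of_real_add of_real_mult)
      also have "\<dots> \<le> ?n (x + sX (of_real t * c) x0, y)" by (rule f(4))
      also have "\<dots> \<le> ((nX x + t) powr q + nY y powr q) powr (1 / q)"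
      proof -
        have "nX (x + sX (of_real t * c) x0) \<le> nX x + t"
          using X.nrm_triangle[of x "sX (of_real t * c) x0"] t
          by (simp add: X.nrm_scale norm_mult c(1) x0)
        then show ?thesis
          unfolding n using assms(7)
          by (intro powr_mono2 add_right_mono) (auto simp: X.nrm_nonneg)
      qed
      finally show "1 + t * u \<le> ((nX x + t) powr q + nY y powr q) powr (1 / q)" .
    qed (simp add: u_def)
    have "norm (f (T z)) = norm (g y) * u"
    proof -
      have "T z = ?s (g y) (x0, 0)" by (simp add: T_def z scale)
      then show ?thesis by (simp only: f.scale norm_mult u_def)
    qed
    also have "\<dots> \<le> nY y * nX x powr (q - 1)"
      using \<open>u \<le> nX x powr (q - 1)\<close> g(2) by (intro mult_mono) (auto simp: u_def Y.nrm_nonneg)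
    also have "\<dots> \<le> max (1 / q) (1 / q')"
      by (rule Youngs_inequality_max[OF assms(7,8) X.nrm_nonneg Y.nrm_nonneg unit])
    finally show "(\<Sum>i<k. norm (f (\<T> i z)) powr p) powr (1 / p) \<le> max (1 / q) (1 / q')"
      using collapse[of "\<lambda>w. norm (f w)" z] f.zero by simp
  qed (use vs nonneg definite hom Pi_ne T_bounded T_norm assms(5) in auto)
qed

end
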